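(* Let $W$ be a contact configuration with $|W|=m$ and bounded cell, and let $r_m$ be the unique solution in $(0,\pi/2)$ of $2r-\sin2r=\frac{2\pi}{m}$. Then $$\mathrm{vol}\bigl(V_c(W)\bigr)\ \ge\ \frac{\pi m}{3}\,\tan^3 r_m .$$
   Context: A contact configuration is a finite set $W\subset S^3\subset\mathbb{R}^4$ of unit vectors with $\langle w,w'\rangle\le\frac12$ for all distinct $w,w'\in W$. Its cell is $V_c(W)=\{x\in\mathbb{R}^4:\langle x,w\rangle\le1\text{ for all }w\in W\}$. *)

theory Defs
  imports "HOL-Analysis.Analysis"
begin

definition contact_configuration :: "(real ^ 4) set \<Rightarrow> bool" where
  "contact_configuration W \<longleftrightarrow>
     finite W \<and> W \<subseteq> sphere 0 1 \<and>
     (\<forall>w\<in>W. \<forall>w'\<in>W. w \<noteq> w' \<longrightarrow> w \<bullet> w' \<le> 1 / 2)"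

definition contact_cell :: "(real ^ 4) set \<Rightarrow> (real ^ 4) set" where
  "contact_cell W = {x. \<forall>w\<in>W. x \<bullet> w \<le> 1}"

definition is_contact_radius :: "nat \<Rightarrow> real \<Rightarrow> bool" where
  "is_contact_radius m r \<longleftrightarrow>
     0 < r \<and> r < pi / 2 \<and> 2 * r - sin (2 * r) = 2 * pi / real m"

(* The description is proper exactly when m \<ge> 3: on (0, pi/2) the left-hand side of the
   equation increases strictly from 0 to pi. *)
definition contact_radius :: "nat \<Rightarrow> real" where
  "contact_radius m = (THE r. is_contact_radius m r)"

end

theory Submission
  imports Defs
begin

text \<open>
  Let \<open>R = 1 / cos r\<close>. The part of the ball of radius \<open>R\<close> about the origin that lies outside the
  cell is covered by the \<open>m\<close> caps \<open>{x. norm x \<le> R \<and> 1 < x \<bullet> w}\<close>, so the volume of the cell is at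
  least that of the ball minus \<open>m\<close> times that of a cap. The equation for \<open>r\<close> says that \<open>m\<close>
  spherical sectors of angular radius \<open>r\<close> have the volume of the whole ball, and a sector is a cap
  together with a cone of height \<open>1\<close> over a three-dimensional ball of radius \<open>tan r\<close>; the lower
  bound is thus the total volume of \<open>m\<close> such cones.
\<close>

section \<open>An antiderivative for the volume of a four-dimensional cap\<close>

lemma has_integral_sqrt_cubed:
  fixes a R :: real
  assumes "0 < R" "\<bar>a\<bar> \<le> R"
  shows "((\<lambda>t. sqrt (R\<^sup>2 - t\<^sup>2) ^ 3) has_integral
           (3 / 8 * R ^ 4 * arccos (a / R) - a * (5 * R\<^sup>2 - 2 * a\<^sup>2) * sqrt (R\<^sup>2 - a\<^sup>2) / 8)) {a..R}"
proof -
  \<comment> \<open>The substitution \<open>t = R * cos u\<close> turns the integral into that of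
    \<open>R ^ 4 * sin u ^ 4\<close> over \<open>u\<close> from 0 to \<open>arccos (a / R)\<close>;
    \<open>F\<close> is the resulting antiderivative written in \<open>t\<close>, with
    \<open>F R = 0\<close>.\<close>
  define F where
    "F t = t * (5 * R\<^sup>2 - 2 * t\<^sup>2) * sqrt (R\<^sup>2 - t\<^sup>2) / 8 - 3 / 8 * R ^ 4 * arccos (t / R)" for t
  have "((\<lambda>t. sqrt (R\<^sup>2 - t\<^sup>2) ^ 3) has_integral (F R - F a)) {a..R}"
  \<comment> \<open>The square root and the arccosine in \<open>F\<close> are not differentiable at
    \<open>t = R\<close>, so derivatives are taken in the open interval only and \<open>F\<close> is
    merely continuous at the ends.\<close>
  proof (rule fundamental_theorem_of_calculus_interior)
    show "a \<le> R" using assms by simp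
    show "continuous_on {a..R} F"
      unfolding F_def using assms
      by (intro continuous_intros) (auto simp: field_simps)
    fix t assume t: "t \<in> {a<..<R}"
    then have "\<bar>t\<bar> < R" using assms by auto
    then have sq: "t\<^sup>2 < R\<^sup>2"
      using assms by (metis abs_ge_zero power2_abs power_strict_mono zero_less_numeral)
    define s where "s = sqrt (R\<^sup>2 - t\<^sup>2)"
    have s: "s > 0" "s\<^sup>2 = R\<^sup>2 - t\<^sup>2" using sq by (auto simp: s_def)
    have "sqrt (1 - (t / R)\<^sup>2) = sqrt (s\<^sup>2 / R\<^sup>2)"
      using assms s(2) by (simp add: field_simps)
    also have "\<dots> = s / R"
      using assms s(1) by (simp add: real_sqrt_divide)
    finally have arc: "sqrt (1 - (t / R)\<^sup>2) = s / R" .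
    have range: "-1 < t / R" "t / R < 1"
      using \<open>\<bar>t\<bar> < R\<close> assms by (auto simp: field_simps abs_less_iff)
    have d1: "((\<lambda>t. arccos (t / R)) has_real_derivative - (1 / s)) (at t)"
    proof -
      have "R \<noteq> 0" using assms by simp
      then have "((\<lambda>t. t / R) has_real_derivative 1 / R) (at t)"
        by (auto intro!: derivative_eq_intros)
      from DERIV_chain2[where f = arccos and g = "\<lambda>t. t / R" and x = t, OF DERIV_arccos[OF range] this]
      show ?thesis unfolding arc using \<open>R \<noteq> 0\<close> by (simp add: inverse_eq_divide)
    qed
    have d2: "((\<lambda>t. sqrt (R\<^sup>2 - t\<^sup>2)) has_real_derivative - (t / s)) (at t)"
    proof -
      have "((\<lambda>t. R\<^sup>2 - t\<^sup>2) has_real_derivative - (2 * t)) (at t)"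
        by (auto intro!: derivative_eq_intros)
      from DERIV_chain2[where f = sqrt and g = "\<lambda>t. R\<^sup>2 - t\<^sup>2" and x = t, OF DERIV_real_sqrt this]
      have "((\<lambda>t. sqrt (R\<^sup>2 - t\<^sup>2)) has_real_derivative inverse s / 2 * - (2 * t)) (at t)"
        using sq unfolding s_def by simp
      moreover have "inverse s / 2 * - (2 * t) = - (t / s)"
        by (simp add: inverse_eq_divide)
      ultimately show ?thesis by (simp only:)
    qed
    have d3: "((\<lambda>t. t * (5 * R\<^sup>2 - 2 * t\<^sup>2)) has_real_derivative 5 * R\<^sup>2 - 6 * t\<^sup>2) (at t)"
      by (auto intro!: derivative_eq_intros simp: algebra_simps power2_eq_square)
    have "(F has_real_derivative
        ((5 * R\<^sup>2 - 6 * t\<^sup>2) * s + - (t / s) * (t * (5 * R\<^sup>2 - 2 * t\<^sup>2))) / 8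
          - 3 / 8 * R ^ 4 * - (1 / s)) (at t)"
      unfolding F_def s_def
      by (rule DERIV_diff DERIV_cdivide DERIV_cmult DERIV_mult d1[unfolded s_def] d2[unfolded s_def] d3)+
    moreover have "((5 * R\<^sup>2 - 6 * t\<^sup>2) * s + - (t / s) * (t * (5 * R\<^sup>2 - 2 * t\<^sup>2))) / 8
          - 3 / 8 * R ^ 4 * - (1 / s) = s ^ 3" (is "?D = _")
    proof -
      \<comment> \<open>After multiplication by \<open>8 * s\<close> only even powers of
        \<open>s\<close> remain, and these are polynomials in \<open>R\<close> and \<open>t\<close>.
        The factor \<open>s > 0\<close> is cancelled at the end.\<close>
      have "8 * (s ^ 3 * s) = 8 * (s\<^sup>2)\<^sup>2"
        by (simp add: power2_eq_square power3_eq_cube)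
      also have "\<dots> = (5 * R\<^sup>2 - 6 * t\<^sup>2) * s\<^sup>2 - t\<^sup>2 * (5 * R\<^sup>2 - 2 * t\<^sup>2) + 3 * R ^ 4"
        unfolding s(2) by algebra
      also have "\<dots> = 8 * (?D * s)"
        using s(1) by (simp add: field_simps power2_eq_square)
      finally show ?thesis using s(1) by simp
    qed
    ultimately show "(F has_vector_derivative sqrt (R\<^sup>2 - t\<^sup>2) ^ 3) (at t)"
      by (simp add: has_real_derivative_iff_has_vector_derivative s_def)
  qed
  then show ?thesis using assms by (simp add: F_def)
qed

section \<open>Lebesgue measure on \<open>real ^ 4\<close> as a product measure\<close>

definition vec4_of_pair :: "real \<times> (real ^ 3) \<Rightarrow> real ^ 4" where
  "vec4_of_pair p = vector [fst p, snd p $ 1, snd p $ 2, snd p $ 3]"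

lemma vec4_of_pair_nth [simp]:
  "vec4_of_pair p $ 1 = fst p" "vec4_of_pair p $ 2 = snd p $ 1"
  "vec4_of_pair p $ 3 = snd p $ 2" "vec4_of_pair p $ 4 = snd p $ 3"
  by (simp_all add: vec4_of_pair_def vector_def)

lemma norm_vec4_of_pair: "(norm (vec4_of_pair p))\<^sup>2 = (fst p)\<^sup>2 + (norm (snd p))\<^sup>2"
  unfolding power2_norm_eq_inner inner_vec_def by (simp add: sum_4 sum_3 power2_eq_square)

lemma continuous_vec4_of_pair: "continuous_on UNIV vec4_of_pair"
proof -
  have "continuous_on UNIV (\<lambda>p. vec4_of_pair p $ i)" for i
    using exhaust_4[of i] by (elim disjE; simp; intro continuous_intros)
  then have "continuous_on UNIV (\<lambda>p. \<chi> i. vec4_of_pair p $ i)"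
    by (intro continuous_on_vec_lambda)
  then show ?thesis by simp
qed

lemma measurable_vec4_of_pair [measurable]: "vec4_of_pair \<in> borel_measurable borel"
  by (rule borel_measurable_continuous_onI[OF continuous_vec4_of_pair])

lemma prod_Basis_vec: "(\<Prod>b\<in>Basis. x \<bullet> b) = (\<Prod>i\<in>UNIV. x $ i)" for x :: "real ^ 'n"
proof -
  have "(\<Prod>b\<in>Basis. x \<bullet> b) = (\<Prod>b\<in>range (\<lambda>i. axis i (1::real)). x \<bullet> b)"
    by (rule arg_cong[where f = "prod _"]) (auto simp: Basis_vec_def)
  also have "\<dots> = (\<Prod>i\<in>UNIV. x $ i)"
    by (subst prod.reindex) (auto simp: inj_on_def axis_eq_axis inner_axis)
  finally show ?thesis .
qed

text \<open>Lebesgue measure is determined by its values on boxes, and the preimage of a box is an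
  interval times a three-dimensional box. This makes integration over slices along the first
  coordinate available.\<close>

lemma lborel_vec4: "(lborel :: (real ^ 4) measure) = distr lborel borel vec4_of_pair"
proof (rule lborel_eqI)
  fix l u :: "real ^ 4"
  assume "\<And>b. b \<in> Basis \<Longrightarrow> l \<bullet> b \<le> u \<bullet> b"
  then have le: "l $ i \<le> u $ i" for i
    by (force simp: Basis_vec_def inner_axis)
  define l' u' :: "real ^ 3" where
    "l' = vector [l $ 2, l $ 3, l $ 4]" and "u' = vector [u $ 2, u $ 3, u $ 4]"
  have le': "l' $ i \<le> u' $ i" for i
    using exhaust_3[of i] le by (auto simp: l'_def u'_def)
  have vim: "vec4_of_pair -` box l u = box (l $ 1) (u $ 1) \<times> box l' u'"
    by (auto simp: box_real mem_box_cart forall_4 forall_3 l'_def u'_def)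
  have "emeasure (distr lborel borel vec4_of_pair) (box l u)
      = emeasure (lborel \<Otimes>\<^sub>M lborel) (box (l $ 1) (u $ 1) \<times> box l' u')"
    by (subst emeasure_distr) (auto simp: vim lborel_prod)
  also have "\<dots> = emeasure lborel (box (l $ 1) (u $ 1)) * emeasure lborel (box l' u')"
    by (intro lborel.emeasure_pair_measure_Times) auto
  also have "\<dots> = ennreal (u $ 1 - l $ 1) * ennreal (\<Prod>b\<in>Basis. (u' - l') \<bullet> b)"
  proof -
    have "emeasure lborel (box l' u') = ennreal (\<Prod>b\<in>Basis. (u' - l') \<bullet> b)"
      by (rule emeasure_lborel_box) (use le' in \<open>auto simp: Basis_vec_def inner_axis\<close>)
    then show ?thesis using le[of 1] by (simp add: box_real)
  qed
  also have "\<dots> = (\<Prod>b\<in>Basis. (u - l) \<bullet> b)"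
  proof -
    have "(\<Prod>b\<in>Basis. (u - l) \<bullet> b) = (u $ 1 - l $ 1) * (\<Prod>b\<in>Basis. (u' - l') \<bullet> b)"
      unfolding prod_Basis_vec UNIV_4 UNIV_3 by (simp add: l'_def u'_def)
    then show ?thesis using le[of 1] by (simp add: ennreal_mult')
  qed
  finally show "emeasure (distr lborel borel vec4_of_pair) (box l u) = (\<Prod>b\<in>Basis. (u - l) \<bullet> b)" .
qed simp

section \<open>Volumes of caps of a four-dimensional ball\<close>

definition ball_cap :: "real \<Rightarrow> real \<Rightarrow> 'a::euclidean_space \<Rightarrow> 'a set" where
  "ball_cap R a w = {x. norm x \<le> R \<and> a < x \<bullet> w}"

lemma ball_cap_borel: "ball_cap R a w \<in> sets borel"
  unfolding ball_cap_def by measurable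

lemma ball_cap_lmeasurable: "ball_cap R a w \<in> lmeasurable"
  by (rule bounded_set_imp_lmeasurable)
     (auto simp: ball_cap_def bounded_iff intro: ball_cap_borel[unfolded ball_cap_def])

text \<open>The slice at height \<open>t\<close> is a three-dimensional ball of radius
  \<open>sqrt (R\<^sup>2 - t\<^sup>2)\<close>, so Cavalieri's principle reduces the volume to the
  integral above.\<close>

lemma measure_ball_cap_axis:
  fixes a R :: real
  assumes "0 < R" "\<bar>a\<bar> \<le> R"
  shows "measure lebesgue (ball_cap R a (axis 1 1 :: real ^ 4)) =
    4 / 3 * pi * (3 / 8 * R ^ 4 * arccos (a / R) - a * (5 * R\<^sup>2 - 2 * a\<^sup>2) * sqrt (R\<^sup>2 - a\<^sup>2) / 8)"
    (is "_ = 4 / 3 * pi * ?I")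
proof -
  let ?S = "ball_cap R a (axis 1 1 :: real ^ 4)"
  let ?P = "vec4_of_pair -` ?S"
  have square_le: "0 \<le> R\<^sup>2 - t\<^sup>2" if "t \<in> {a..R}" for t
  proof -
    have "\<bar>t\<bar> \<le> \<bar>R\<bar>" using that assms by auto
    then show ?thesis by (simp add: abs_le_square_iff)
  qed
  have slice: "Pair t -` ?P = (if t \<in> {a<..R} then cball 0 (sqrt (R\<^sup>2 - t\<^sup>2)) else {})" for t
  proof -
    have "(t, v) \<in> ?P \<longleftrightarrow> t \<in> {a<..R} \<and> norm v \<le> sqrt (R\<^sup>2 - t\<^sup>2)" for v
    proof -
      have "norm (vec4_of_pair (t, v)) \<le> R \<longleftrightarrow> t\<^sup>2 + (norm v)\<^sup>2 \<le> R\<^sup>2"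
        using assms norm_vec4_of_pair[of "(t, v)"]
        by (metis abs_le_square_iff abs_norm_cancel abs_of_pos fst_conv snd_conv)
      moreover have "norm v \<le> sqrt (R\<^sup>2 - t\<^sup>2) \<longleftrightarrow> (norm v)\<^sup>2 \<le> R\<^sup>2 - t\<^sup>2"
        by (metis norm_ge_zero real_le_rsqrt real_sqrt_le_iff real_sqrt_unique)
      moreover have "t \<le> R" if "t\<^sup>2 + (norm v)\<^sup>2 \<le> R\<^sup>2"
        using that assms by (smt (verit) power2_le_imp_le zero_le_power2)
      ultimately show ?thesis
        by (auto simp: ball_cap_def inner_axis)
    qed
    then show ?thesis by auto
  qed
  have P: "?P \<in> sets (lborel \<Otimes>\<^sub>M lborel)"
    using measurable_sets[OF measurable_vec4_of_pair ball_cap_borel[of R a "axis 1 1"]]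
    unfolding lborel_prod by simp
  have "emeasure lborel ?S = emeasure (lborel \<Otimes>\<^sub>M lborel) ?P"
    by (subst lborel_vec4, subst emeasure_distr) (auto simp: lborel_prod ball_cap_borel)
  also have "\<dots> = (\<integral>\<^sup>+t. emeasure lborel (Pair t -` ?P) \<partial>lborel)"
    by (rule lborel.emeasure_pair_measure_alt[OF P])
  also have "\<dots> = (\<integral>\<^sup>+t. ennreal (4 / 3 * pi * sqrt (R\<^sup>2 - t\<^sup>2) ^ 3) * indicator {a..R} t \<partial>lborel)"
  proof (rule nn_integral_cong_AE)
    \<comment> \<open>The slice at \<open>t = a\<close> is empty because the cap is cut off by a
      strict inequality, while the integrand lives on the closed interval; the two sides may differ
      at this one point.\<close>
    have "AE t in lborel. t \<noteq> a" by (rule AE_lborel_singleton)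
    then show "AE t in lborel. emeasure lborel (Pair t -` ?P)
        = ennreal (4 / 3 * pi * sqrt (R\<^sup>2 - t\<^sup>2) ^ 3) * indicator {a..R} t"
    proof eventually_elim
      case (elim t)
      show ?case
        using elim square_le[of t] by (auto simp: slice emeasure_cball unit_ball_vol_3 indicator_def)
    qed
  qed
  also have "\<dots> = ennreal (4 / 3 * pi * ?I)"
  proof (rule nn_integral_has_integral_lebesgue')
    fix t assume "t \<in> {a..R}"
    then show "0 \<le> 4 / 3 * pi * sqrt (R\<^sup>2 - t\<^sup>2) ^ 3" using square_le by simp
  next
    show "((\<lambda>t. 4 / 3 * pi * sqrt (R\<^sup>2 - t\<^sup>2) ^ 3) has_integral 4 / 3 * pi * ?I) {a..R}"
      by (intro has_integral_mult_right has_integral_sqrt_cubed assms)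
  qed
  finally have em: "emeasure lborel ?S = ennreal (4 / 3 * pi * ?I)" .
  \<comment> \<open>\<open>ennreal\<close> sends negative reals to 0, so the sign is needed to read
    off the real value.\<close>
  have "0 \<le> ?I"
  proof (rule has_integral_nonneg[OF has_integral_sqrt_cubed[OF assms]])
    fix t assume "t \<in> {a..R}"
    then show "0 \<le> sqrt (R\<^sup>2 - t\<^sup>2) ^ 3" using square_le by simp
  qed
  then have "measure lborel ?S = 4 / 3 * pi * ?I"
    using em by (simp add: measure_def)
  then show ?thesis
    by (simp add: measure_completion ball_cap_borel)
qed

text \<open>An orthogonal map taking \<open>w\<close> to the first axis preserves volume and carries
  caps to caps.\<close>

lemma measure_ball_cap:
  fixes w :: "real ^ 4"
  assumes "0 < R" "\<bar>a\<bar> \<le> R" "norm w = 1"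
  shows "measure lebesgue (ball_cap R a w) =
    4 / 3 * pi * (3 / 8 * R ^ 4 * arccos (a / R) - a * (5 * R\<^sup>2 - 2 * a\<^sup>2) * sqrt (R\<^sup>2 - a\<^sup>2) / 8)"
proof -
  obtain f :: "real ^ 4 \<Rightarrow> real ^ 4" where f: "orthogonal_transformation f" "f w = axis 1 1"
    using orthogonal_transformation_exists_1[of w "axis 1 1"] assms by auto
  have "f ` ball_cap R a w = ball_cap R a (axis 1 1)"
  proof
    show "f ` ball_cap R a w \<subseteq> ball_cap R a (axis 1 1)"
      using f by (force simp: ball_cap_def orthogonal_transformation_def orthogonal_transformation_norm
          simp flip: f(2))
    show "ball_cap R a (axis 1 1) \<subseteq> f ` ball_cap R a w"
    proof
      fix y :: "real ^ 4" assume y: "y \<in> ball_cap R a (axis 1 1)"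
      obtain x where "y = f x"
        using orthogonal_transformation_surj[OF f(1)] by (metis surjD)
      then show "y \<in> f ` ball_cap R a w"
        using y f(1) by (auto simp: ball_cap_def orthogonal_transformation_def orthogonal_transformation_norm
          simp flip: f(2))
    qed
  qed
  then show ?thesis
    using measure_orthogonal_image[OF f(1) ball_cap_lmeasurable] measure_ball_cap_axis[OF assms(1,2)]
    by metis
qed

text \<open>The union bound holds for every radius \<open>R \<ge> 1\<close>; overlaps of caps are
  counted repeatedly, which only lowers the left-hand side. The radius is fixed in terms of
  \<open>r\<close> later.\<close>

lemma measure_contact_cell_ge:
  assumes "finite W" "W \<subseteq> sphere 0 1" "bounded (contact_cell W)" "1 \<le> R"
  shows "pi\<^sup>2 / 2 * R ^ 4 - real (card W) * (4 / 3 * pi *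
      (3 / 8 * R ^ 4 * arccos (1 / R) - (5 * R\<^sup>2 - 2) * sqrt (R\<^sup>2 - 1) / 8)) \<le> measure lebesgue (contact_cell W)"
    (is "_ - _ * ?c \<le> _")
proof -
  have "contact_cell W = (\<Inter>w\<in>W. {x. w \<bullet> x \<le> 1})"
    by (auto simp: contact_cell_def inner_commute)
  then have "closed (contact_cell W)"
    by (auto intro!: closed_INT closed_halfspace_le)
  then have V: "contact_cell W \<in> lmeasurable"
    using assms(3) by (simp add: compact_eq_bounded_closed lmeasurable_compact)
  have caps: "(\<Union>w\<in>W. ball_cap R 1 w) \<in> lmeasurable"
    using assms(1) by (intro fmeasurable.finite_UN) (auto intro: ball_cap_lmeasurable)
  have "pi\<^sup>2 / 2 * R ^ 4 = measure lebesgue (cball (0 :: real ^ 4) R)"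
    using assms(4) by (simp add: measure_completion content_cball unit_ball_vol_4)
  \<comment> \<open>The strict inequality in \<open>ball_cap\<close> is exactly the negation of a
    constraint of the cell, so no point of the ball is missed.\<close>
  also have "\<dots> \<le> measure lebesgue (contact_cell W \<union> (\<Union>w\<in>W. ball_cap R 1 w))"
    by (rule measure_mono_fmeasurable)
       (use V caps in \<open>auto simp: contact_cell_def ball_cap_def not_le\<close>)
  also have "\<dots> \<le> measure lebesgue (contact_cell W) + measure lebesgue (\<Union>w\<in>W. ball_cap R 1 w)"
    using V caps by (intro measure_Un_le) auto
  also have "measure lebesgue (\<Union>w\<in>W. ball_cap R 1 w) \<le> (\<Sum>w\<in>W. measure lebesgue (ball_cap R 1 w))"
    by (intro measure_UNION_le assms fmeasurableD ball_cap_lmeasurable)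
  also have "(\<Sum>w\<in>W. measure lebesgue (ball_cap R 1 w)) = (\<Sum>w\<in>W. ?c)"
    using assms(2,4) by (intro sum.cong refl) (subst measure_ball_cap; auto)
  finally show ?thesis by simp
qed

section \<open>Existence and uniqueness of the contact radius\<close>

lemma bounded_contact_cell_card:
  assumes "finite W" "bounded (contact_cell W)"
  shows "4 \<le> card W"
proof (rule ccontr)
  assume "\<not> 4 \<le> card W"
  then have "dim W < DIM(real ^ 4)"
    using dim_le_card'[OF assms(1)] by simp
  \<comment> \<open>The whole line through a nonzero vector orthogonal to \<open>W\<close> satisfies
    every constraint as \<open>0 \<le> 1\<close>, so the cell is unbounded.\<close>
  then obtain x :: "real ^ 4" where x: "x \<noteq> 0" "\<And>y. y \<in> span W \<Longrightarrow> orthogonal x y"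
    using orthogonal_to_subspace_exists by blast
  then have "c *\<^sub>R x \<in> contact_cell W" for c
    using span_base by (fastforce simp: contact_cell_def orthogonal_def)
  moreover obtain B where "\<And>y. y \<in> contact_cell W \<Longrightarrow> norm y \<le> B"
    using assms(2) by (auto simp: bounded_iff)
  ultimately have "norm (((\<bar>B\<bar> + 1) / norm x) *\<^sub>R x) \<le> B" by blast
  then show False using x(1) by simp
qed

text \<open>For \<open>m \<ge> 4\<close> the target \<open>2 * pi / m\<close> lies strictly between
  the end values 0 and \<open>pi\<close> of the left-hand side, so the intermediate value theorem
  gives a root and both endpoints are excluded. Strict monotonicity gives uniqueness.\<close>

lemma ex1_contact_radius:
  assumes "4 \<le> m"
  shows "\<exists>!r. is_contact_radius m r"
proof -
  define f where "f r = 2 * r - sin (2 * r)" for r :: real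
  have mono: "f x < f y" if "0 \<le> x" "x < y" "y \<le> pi / 2" for x y
  proof (rule DERIV_pos_imp_increasing_open[OF that(2)])
    fix t assume t: "x < t" "t < y"
    have "(f has_real_derivative 2 - 2 * cos (2 * t)) (at t)"
      unfolding f_def by (auto intro!: derivative_eq_intros)
    moreover have "cos (2 * t) < cos 0"
      using that t by (intro cos_monotone_0_pi) auto
    ultimately show "\<exists>z. (f has_real_derivative z) (at t) \<and> 0 < z" by force
  qed (auto simp: f_def intro!: continuous_intros)
  have target: "0 < 2 * pi / m" "2 * pi / m < pi"
    using assms by (auto simp: field_simps)
  have "\<exists>r\<ge>0. r \<le> pi / 2 \<and> f r = 2 * pi / m"
    by (rule IVT') (use target in \<open>auto simp: f_def intro!: continuous_intros\<close>)
  then obtain r where r: "0 \<le> r" "r \<le> pi / 2" "f r = 2 * pi / m" by blast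
  have "r \<noteq> 0"
    using r(3) target(1) by (auto simp: f_def)
  moreover have "r \<noteq> pi / 2"
  proof
    assume "r = pi / 2"
    then have "f r = f (pi / 2)" by (rule arg_cong)
    also have "\<dots> = pi" by (simp add: f_def)
    finally show False using r(3) target(2) by simp
  qed
  ultimately have "is_contact_radius m r"
    using r by (auto simp: is_contact_radius_def f_def)
  moreover have "s = r" if "is_contact_radius m s" for s
    using mono[of r s] mono[of s r] that r
    by (fastforce simp: is_contact_radius_def f_def)
  ultimately show ?thesis by blast
qed

theorem theorem7p16:
  fixes W :: "(real ^ 4) set" and m :: nat
  assumes "contact_configuration W"
    and "card W = m"
    and "bounded (contact_cell W)"
  shows "(\<exists>!r. is_contact_radius m r) \<and>
         measure lebesgue (contact_cell W) \<ge> pi * real m / 3 * tan (contact_radius m) ^ 3"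
proof
  have W: "finite W" "W \<subseteq> sphere 0 1"
    using assms(1) by (auto simp: contact_configuration_def)
  have m: "4 \<le> m"
    using bounded_contact_cell_card[OF W(1) assms(3)] assms(2) by simp
  show ex1: "\<exists>!r. is_contact_radius m r"
    by (rule ex1_contact_radius[OF m])
  define r where "r = contact_radius m"
  have "is_contact_radius m r"
    unfolding r_def contact_radius_def by (rule theI'[OF ex1])
  then have r: "0 < r" "r < pi / 2" and eq: "2 * r - sin (2 * r) = 2 * pi / m"
    by (auto simp: is_contact_radius_def)
  define T where "T = tan r"
  \<comment> \<open>With this radius a hyperplane at distance 1 cuts off a cap of angular radius
    \<open>r\<close>, whose base is a three-dimensional ball of radius \<open>T\<close>.\<close>
  define R where "R = 1 / cos r"
  have c: "0 < cos r" "0 < T"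
    using r by (auto simp: T_def cos_gt_zero_pi tan_gt_zero)
  have R2: "R\<^sup>2 = 1 + T\<^sup>2"
    using tan_sec[of r] c by (simp add: R_def T_def inverse_eq_divide power_one_over)
  have R: "1 \<le> R" using c by (simp add: R_def)
  have arc: "arccos (1 / R) = r"
    using r by (simp add: R_def arccos_cos)
  have root: "sqrt (R\<^sup>2 - 1) = T"
    using R2 c by simp
  have "sin (2 * r) = 2 * T * (cos r)\<^sup>2"
    using c by (simp add: sin_double T_def tan_def power2_eq_square)
  also have "(cos r)\<^sup>2 = 1 / R\<^sup>2"
    by (simp add: R_def power_one_over)
  finally have "pi / m = r - T / R\<^sup>2"
    using eq by simp
  then have pi_eq: "pi * R\<^sup>2 = m * (r * R\<^sup>2 - T)"
    using R m by (simp add: field_simps)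
  \<comment> \<open>Replacing one factor \<open>pi * R\<^sup>2\<close> by \<open>pi_eq\<close>
    expresses the ball through \<open>m\<close> sectors. The terms with \<open>r * R ^ 4\<close>
    then cancel against the caps, leaving the cones.\<close>
  have "pi\<^sup>2 / 2 * R ^ 4 = pi / 2 * R\<^sup>2 * (pi * R\<^sup>2)" by algebra
  also have "\<dots> = m * (pi / 2 * (r * R ^ 4 - T * R\<^sup>2))"
    unfolding pi_eq by algebra
  finally have "pi\<^sup>2 / 2 * R ^ 4 - m * (4 / 3 * pi * (3 / 8 * R ^ 4 * r - (5 * R\<^sup>2 - 2) * T / 8))
      = m * pi * T / 3 * (R\<^sup>2 - 1)"
    by (simp add: field_simps)
  also have "\<dots> = pi * m / 3 * T ^ 3"
    unfolding R2 by (simp add: power2_eq_square power3_eq_cube)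
  finally have bound: "pi\<^sup>2 / 2 * R ^ 4
      - m * (4 / 3 * pi * (3 / 8 * R ^ 4 * r - (5 * R\<^sup>2 - 2) * T / 8)) = pi * m / 3 * T ^ 3" .
  have "pi * m / 3 * T ^ 3 \<le> measure lebesgue (contact_cell W)"
    using measure_contact_cell_ge[OF W assms(3) R] unfolding assms(2) arc root bound .
  then show "measure lebesgue (contact_cell W) \<ge> pi * real m / 3 * tan (contact_radius m) ^ 3"
    unfolding T_def r_def .
qed

end
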